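(* Let $(X,\delta,\Lambda)$ be a guided dynamical system with $X$ compact, $\delta=(\delta_1,\dots,\delta_N)$, $\Lambda=(\Lambda_1,\dots,\Lambda_N)$, having a $\Lambda$-weak attractor $x_0\in X$. Assume that $F:X\to\mathbb{R}^n$ is a continuous solution of the equation $$F(x)-\sum_{i=1}^N A_i(x)\,F(\delta_i(x))=0,\qquad x\in X,$$ where the coefficients $A_i:X\to\mathbb{R}^{n\times n}$ are such that $A_i(x)$ is a lower triangular matrix with non-negative diagonal entries for all $i$ and all $x\in X$, $\det(A_i(x))>0$ for all $i$ and all $x\notin\Lambda_i$, and $\sum_{i=1}^N A_i(x)=I$ (the identity matrix) for all $x\in X$. Then $F$ is constant.
   Context: A guided dynamical system $(X,\delta,\Lambda)$ consists of a metric space $X$, a finite family $\delta=(\delta_1,\dots,\delta_N)$ of continuous maps $\delta_i:X\to X$, and a family $\Lambda=(\Lambda_1,\dots,\Lambda_N)$ of closed subsets of $X$ (guiding sets); it is always assumed that $\bigcap_{i=1}^N\Lambda_i=\emptyset$. A $\Lambda$-proper orbit emanating from $x_1$ is a finite or infinite sequence $(x_1,x_2,\dots)$ such that for every $j\ge 2$ there is an index $i$ with $x_{j-1}\notin\Lambda_i$ and $x_j=\delta_i(x_{j-1})$. The $\Lambda$-orbit set $\Lambda\text{-}OS(x)$ is the set of all $y$ for which there is a finite $\Lambda$-proper orbit $(x,\dots,y)$ (the one-term orbit $(x)$ is allowed). A point $x_0\in X$ is a $\Lambda$-weak attractor if $x_0\in\bigcap_{x\in X}\overline{\Lambda\text{-}OS(x)}$.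 *)

theory Defs
  imports "HOL-Analysis.Analysis"
begin

text \<open>
  The space is an abstract metric space with carrier \<open>X\<close>, so no ambient type-class metric is
  involved. The maps and guiding sets are indexed by \<open>{1..N}\<close>; values at other indices, and values of
  the maps outside \<open>X\<close>, are irrelevant. As an empty intersection over \<open>{1..0}\<close> is \<open>UNIV\<close>, the
  assumption \<open>Inter_guiding\<close> also forces \<open>N \<ge> 1\<close>.
\<close>

locale guided_dynamical_system = Metric_space X d
  for X :: "'a set" and d :: "'a \<Rightarrow> 'a \<Rightarrow> real" +
  fixes N :: nat
    and \<delta> :: "nat \<Rightarrow> 'a \<Rightarrow> 'a"
    and \<Lambda> :: "nat \<Rightarrow> 'a set"
  assumes continuous_maps: "\<And>i. i \<in> {1..N} \<Longrightarrow> continuous_map mtopology mtopology (\<delta> i)"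
    and closed_guiding: "\<And>i. i \<in> {1..N} \<Longrightarrow> closedin mtopology (\<Lambda> i)"
    and Inter_guiding: "(\<Inter>i\<in>{1..N}. \<Lambda> i) = {}"
begin

text \<open>Finite proper orbits, as nonempty lists; the one-term orbit \<open>[x]\<close> is included.\<close>

definition proper_orbit :: "'a \<Rightarrow> 'a list \<Rightarrow> bool" where
  "proper_orbit x xs \<longleftrightarrow>
     xs \<noteq> [] \<and> set xs \<subseteq> X \<and> hd xs = x \<and>
     (\<forall>j. Suc j < length xs \<longrightarrow>
        (\<exists>i\<in>{1..N}. xs ! j \<notin> \<Lambda> i \<and> xs ! Suc j = \<delta> i (xs ! j)))"

definition orbit_set :: "'a \<Rightarrow> 'a set" where
  "orbit_set x = {y. \<exists>xs. proper_orbit x xs \<and> last xs = y}"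

definition weak_attractor :: "'a \<Rightarrow> bool" where
  "weak_attractor x0 \<longleftrightarrow> x0 \<in> X \<and> x0 \<in> (\<Inter>x\<in>X. mtopology closure_of orbit_set x)"

end

definition lower_triangular :: "'a::zero^('n::{finite,wellorder})^('n::{finite,wellorder}) \<Rightarrow> bool" where
  "lower_triangular A \<longleftrightarrow> (\<forall>i j. i < j \<longrightarrow> A $ i $ j = 0)"

end

theory Submission
  imports Defs
begin

text \<open>
  Suppose that the components of \<open>F\<close> before the \<open>k\<close>-th one are constant. Since the off-diagonal entries
  of the matrices sum to \<open>0\<close>, the \<open>k\<close>-th component is then at each \<open>x\<close> a convex combination of its
  values at the points \<open>\<delta>\<^sub>i x\<close>, with positive weight wherever \<open>x \<notin> \<Lambda>\<^sub>i\<close>. Its maximum therefore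
  propagates along proper orbits and, by continuity, to the weak attractor. The same holds for its
  minimum, so both extreme values are attained at the attractor.
\<close>

text \<open>The nonnegative terms \<open>a i * (M - v i)\<close> sum to zero, so each of them
  vanishes.\<close>

lemma convex_combination_eq_bound:
  fixes a v :: "'i \<Rightarrow> real"
  assumes "finite I" "\<And>i. i \<in> I \<Longrightarrow> a i \<ge> 0" "sum a I = 1"
    and "\<And>i. i \<in> I \<Longrightarrow> v i \<le> M" "(\<Sum>i\<in>I. a i * v i) = M"
    and "i \<in> I" "a i > 0"
  shows "v i = M"
proof -
  have "(\<Sum>i\<in>I. a i * (M - v i)) = sum a I * M - (\<Sum>i\<in>I. a i * v i)"
    by (simp add: right_diff_distrib sum_subtractf sum_distrib_right)
  also have "\<dots> = 0"
    using assms by simp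
  finally have "a i * (M - v i) = 0"
    using sum_nonneg_eq_0_iff[of I "\<lambda>i. a i * (M - v i)"] assms(1,2,4,6) by simp
  then show ?thesis
    using assms(7) by simp
qed

context guided_dynamical_system
begin

lemma orbit_set_subset: "orbit_set x \<subseteq> X"
  unfolding orbit_set_def proper_orbit_def using last_in_set by fastforce

text \<open>Induction along the positions of a proper orbit. It turns the list encoding into a
  closure principle, so that later arguments need not mention lists.\<close>

lemma orbit_set_invariant:
  assumes "y \<in> orbit_set x" "P x"
    and step: "\<And>z i. z \<in> X \<Longrightarrow> i \<in> {1..N} \<Longrightarrow> z \<notin> \<Lambda> i \<Longrightarrow> P z \<Longrightarrow> P (\<delta> i z)"
  shows "P y"
proof -
  obtain xs where xs: "proper_orbit x xs" "last xs = y"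
    using assms(1) unfolding orbit_set_def by blast
  have "P (xs ! j)" if "j < length xs" for j
    using that
  proof (induction j)
    case 0
    then show ?case
      using xs \<open>P x\<close> by (simp add: proper_orbit_def hd_conv_nth)
  next
    case (Suc j)
    then obtain i where i: "i \<in> {1..N}" "xs ! j \<notin> \<Lambda> i" "xs ! Suc j = \<delta> i (xs ! j)"
      using xs unfolding proper_orbit_def by blast
    moreover have "xs ! j \<in> X"
      using Suc.prems xs unfolding proper_orbit_def by (meson Suc_lessD nth_mem subsetD)
    ultimately show ?case
      using step Suc by simp
  qed
  moreover have "xs \<noteq> []"
    using xs by (simp add: proper_orbit_def)
  ultimately show ?thesis
    using xs by (metis last_conv_nth diff_less length_greater_0_conv zero_less_one)
qed

text \<open>By compactness \<open>f\<close> has a maximum point \<open>m\<close>. The level set of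
  \<open>f m\<close> is closed under admissible moves and topologically closed, so it contains the
  closure of \<open>orbit_set m\<close>, where \<open>x0\<close> lies.\<close>

lemma weak_attractor_maximum:
  fixes f :: "'a \<Rightarrow> real"
  assumes "compact_space mtopology" "weak_attractor x0"
    and cont: "continuous_map mtopology euclideanreal f"
    and nonneg: "\<And>i x. i \<in> {1..N} \<Longrightarrow> x \<in> X \<Longrightarrow> a i x \<ge> 0"
    and pos: "\<And>i x. i \<in> {1..N} \<Longrightarrow> x \<in> X - \<Lambda> i \<Longrightarrow> a i x > 0"
    and sum1: "\<And>x. x \<in> X \<Longrightarrow> (\<Sum>i=1..N. a i x) = 1"
    and mean: "\<And>x. x \<in> X \<Longrightarrow> (\<Sum>i=1..N. a i x * f (\<delta> i x)) = f x"
    and "x \<in> X"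
  shows "f x \<le> f x0"
proof -
  have "compact (f ` X)"
    using image_compactin[OF _ cont, of X] assms(1) by (simp add: compact_space_def)
  then obtain m where m: "m \<in> X" "\<And>y. y \<in> X \<Longrightarrow> f y \<le> f m"
    using compact_attains_sup[of "f ` X"] \<open>x \<in> X\<close> by blast
  have maps: "\<delta> i z \<in> X" if "i \<in> {1..N}" "z \<in> X" for i z
    using continuous_map_image_subset_topspace[OF continuous_maps[OF that(1)]] that(2) by auto
  have "f y = f m" if "y \<in> orbit_set m" for y
    using that
  proof (rule orbit_set_invariant)
    fix z i
    assume z: "z \<in> X" and i: "i \<in> {1..N}" and "z \<notin> \<Lambda> i" and "f z = f m"
    then show "f (\<delta> i z) = f m"
      \<comment> \<open>Since \<open>f z = f m\<close>, the weighted mean of the values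
        \<open>f (\<delta> i z)\<close> equals their upper bound \<open>f m\<close>, and
        \<open>z \<notin> \<Lambda> i\<close> makes the \<open>i\<close>-th weight positive.\<close>
      using convex_combination_eq_bound[of "{1..N}" "\<lambda>i. a i z" "\<lambda>i. f (\<delta> i z)" "f m" i]
        nonneg pos sum1 mean m maps by simp
  qed simp
  then have "orbit_set m \<subseteq> {y \<in> topspace mtopology. f y \<in> {f m}}"
    using orbit_set_subset by auto
  then have "mtopology closure_of orbit_set m \<subseteq> {y \<in> topspace mtopology. f y \<in> {f m}}"
    using closedin_continuous_map_preimage[OF cont, of "{f m}"]
    by (intro closure_of_minimal) auto
  then have "f x0 = f m"
    using assms(2) m unfolding weak_attractor_def by blast
  then show ?thesis
    using m \<open>x \<in> X\<close> by simp
qed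

text \<open>The mean value equation is linear in \<open>f\<close>, so the maximum bound applies to
  \<open>- f\<close> with the same weights.\<close>

lemma weak_attractor_constant:
  fixes f :: "'a \<Rightarrow> real"
  assumes "compact_space mtopology" "weak_attractor x0"
    and "continuous_map mtopology euclideanreal f"
    and "\<And>i x. i \<in> {1..N} \<Longrightarrow> x \<in> X \<Longrightarrow> a i x \<ge> 0"
    and "\<And>i x. i \<in> {1..N} \<Longrightarrow> x \<in> X - \<Lambda> i \<Longrightarrow> a i x > 0"
    and "\<And>x. x \<in> X \<Longrightarrow> (\<Sum>i=1..N. a i x) = 1"
    and "\<And>x. x \<in> X \<Longrightarrow> (\<Sum>i=1..N. a i x * f (\<delta> i x)) = f x"
    and "x \<in> X"
  shows "f x = f x0"
proof (rule antisym)
  show "f x \<le> f x0"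
    using weak_attractor_maximum[of x0 f a x] assms by simp
  have "continuous_map mtopology euclideanreal (\<lambda>x. - f x)"
    using assms(3) by (simp add: continuous_map_minus)
  then have "- f x \<le> - f x0"
    using weak_attractor_maximum[of x0 "\<lambda>x. - f x" a x] assms by (simp add: sum_negf)
  then show "f x0 \<le> f x"
    by simp
qed

end

lemma lower_triangular_diagonal_pos:
  fixes A :: "real^('n::{finite,wellorder})^('n::{finite,wellorder})"
  assumes "lower_triangular A" "det A > 0" "\<And>k. A $ k $ k \<ge> 0"
  shows "A $ k $ k > 0"
proof -
  have "det A = (\<Prod>k\<in>UNIV. A $ k $ k)"
    using assms(1) by (intro det_lowerdiagonal) (simp add: lower_triangular_def)
  then have "A $ k $ k \<noteq> 0"
    using assms(2) prod_zero[of UNIV "\<lambda>k. A $ k $ k"] by fastforce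
  then show ?thesis
    using assms(3)[of k] by simp
qed

theorem theorem2p1p6:
  fixes X :: "'a set" and d :: "'a \<Rightarrow> 'a \<Rightarrow> real"
    and N :: nat and \<delta> :: "nat \<Rightarrow> 'a \<Rightarrow> 'a" and \<Lambda> :: "nat \<Rightarrow> 'a set"
    and x0 :: 'a
    and A :: "nat \<Rightarrow> 'a \<Rightarrow> real^('n::{finite,wellorder})^('n::{finite,wellorder})"
    and F :: "'a \<Rightarrow> real^('n::{finite,wellorder})"
  assumes "guided_dynamical_system X d N \<delta> \<Lambda>"
    and "compact_space (Metric_space.mtopology X d)"
    and "guided_dynamical_system.weak_attractor X d N \<delta> \<Lambda> x0"
    and "continuous_map (Metric_space.mtopology X d) euclidean F"
    and "\<And>x. x \<in> X \<Longrightarrow> F x - (\<Sum>i=1..N. A i x *v F (\<delta> i x)) = 0"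
    and "\<And>i x. i \<in> {1..N} \<Longrightarrow> x \<in> X \<Longrightarrow> lower_triangular (A i x)"
    and "\<And>i x k. i \<in> {1..N} \<Longrightarrow> x \<in> X \<Longrightarrow> A i x $ k $ k \<ge> 0"
    and "\<And>i x. i \<in> {1..N} \<Longrightarrow> x \<in> X - \<Lambda> i \<Longrightarrow> det (A i x) > 0"
    and "\<And>x. x \<in> X \<Longrightarrow> (\<Sum>i=1..N. A i x) = mat 1"
  shows "F constant_on X"
proof -
  interpret guided_dynamical_system X d N \<delta> \<Lambda>
    by fact
  have maps: "\<delta> i x \<in> X" if "i \<in> {1..N}" "x \<in> X" for i x
    using continuous_map_image_subset_topspace[OF continuous_maps[OF that(1)]] that(2) by auto
  have entry_sum: "(\<Sum>i=1..N. A i x $ k $ j) = (if k = j then 1 else 0)" if "x \<in> X" for x k j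
  proof -
    have "(\<Sum>i=1..N. A i x) $ k $ j = mat 1 $ k $ j"
      using assms(9) that by simp
    then show ?thesis
      by (simp add: mat_def)
  qed
  \<comment> \<open>Strong induction on the row index. Naming the constant as the value at
    \<open>x0\<close> provides numbers \<open>F x0 $ j\<close> to substitute for the earlier
    components.\<close>
  have "\<forall>x\<in>X. F x $ k = F x0 $ k" for k
  proof (induction k rule: less_induct)
    case step: (less k)
    have mean: "(\<Sum>i=1..N. A i x $ k $ k * F (\<delta> i x) $ k) = F x $ k" if x: "x \<in> X" for x
    proof -
      \<comment> \<open>For \<open>j < k\<close> this is the induction hypothesis at
        \<open>\<delta> i x\<close>; for \<open>j > k\<close> the entry is zero and any value would
        do. Off the diagonal the new factor no longer depends on \<open>i\<close>.\<close>
      have row: "A i x $ k $ j * F (\<delta> i x) $ j =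
          A i x $ k $ j * (if j = k then F (\<delta> i x) $ k else F x0 $ j)"
        if "i \<in> {1..N}" for i j
      proof (cases j k rule: linorder_cases)
        case less
        then show ?thesis
          using step[OF less] maps[OF that x] less by (simp add: less_imp_neq)
      next
        case greater
        then show ?thesis
          using assms(6)[OF that x] by (simp add: lower_triangular_def)
      qed simp
      have "F x $ k = (\<Sum>i=1..N. A i x *v F (\<delta> i x)) $ k"
        using assms(5)[OF x] by simp
      also have "\<dots> = (\<Sum>i=1..N. \<Sum>j\<in>UNIV. A i x $ k $ j * F (\<delta> i x) $ j)"
        by (simp add: matrix_vector_mult_def)
      also have "\<dots> = (\<Sum>i=1..N. \<Sum>j\<in>UNIV.
          A i x $ k $ j * (if j = k then F (\<delta> i x) $ k else F x0 $ j))"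
        using row by (intro sum.cong refl)
      \<comment> \<open>With the sum over \<open>i\<close> inside, \<open>F x0 $ j\<close> factors
        out for \<open>j \<noteq> k\<close> and meets an off-diagonal entry sum, which is zero by
        \<open>entry_sum\<close>.\<close>
      also have "\<dots> = (\<Sum>j\<in>UNIV. \<Sum>i=1..N.
          A i x $ k $ j * (if j = k then F (\<delta> i x) $ k else F x0 $ j))"
        by (rule sum.swap)
      also have "\<dots> = (\<Sum>j\<in>UNIV. if j = k
          then (\<Sum>i=1..N. A i x $ k $ k * F (\<delta> i x) $ k) else 0)"
        by (intro sum.cong refl) (auto simp: entry_sum[OF x] simp del: One_nat_def simp flip: sum_distrib_right)
      also have "\<dots> = (\<Sum>i=1..N. A i x $ k $ k * F (\<delta> i x) $ k)"
        by simp
      finally show ?thesis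
        by simp
    qed
    have "continuous_map mtopology euclideanreal ((\<lambda>v. v $ k) \<circ> F)"
      using assms(4) by (rule continuous_map_compose) (simp add: continuous_on_component)
    then have cont: "continuous_map mtopology euclideanreal (\<lambda>x. F x $ k)"
      by (simp add: o_def)
    have diagonal_pos: "A i x $ k $ k > 0" if "i \<in> {1..N}" "x \<in> X - \<Lambda> i" for i x
      using that assms(6-8) by (intro lower_triangular_diagonal_pos) auto
    have "(\<Sum>i=1..N. A i x $ k $ k) = 1" if "x \<in> X" for x
      using entry_sum[OF that] by simp
    \<comment> \<open>The diagonal entries in row \<open>k\<close> serve as the weights of the
      convex combination.\<close>
    then show ?case
      using weak_attractor_constant[OF assms(2,3) cont, of "\<lambda>i x. A i x $ k $ k", OF assms(7)
          diagonal_pos _ mean]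
      by blast
  qed
  then have "F x = F x0" if "x \<in> X" for x
    using that by (simp add: vec_eq_iff)
  then show ?thesis
    unfolding constant_on_def by blast
qed

end
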